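(* Suppose $M$ is a (canonical) LF object such that $\Gamma\vdash_{\Sigma}M:T$ is derivable. Then $inv_{T}(\langle M\rangle)=M$; i.e., there is a derivation of $\Gamma;\langle M\rangle\longrightarrow_{\Sigma}M:T$.
   Context: **LF.** The Edinburgh Logical Framework has kinds $K ::= \mathrm{Type}\mid \Pi x{:}A.K$, types $A,B ::= a\mid \Pi x{:}A.B\mid A\,M$ and objects $M,N ::= c\mid x\mid \lambda x{:}A.M\mid M\,N$ ($a$ type constants, $c$ object constants, $x$ variables), identified up to renaming of bound variables. $\Sigma$ is a valid signature, i.e. a list of declarations $a:K$ and $c:A$ (distinct constants, each $K$, $A$ well-formed in the empty context over the earlier declarations). Contexts are lists of declarations $x:A$. $U^\beta$ is the $\beta$-normal form of $U$. The judgments (with $\vdash$ for $\vdash_\Sigma$) are derived by these rules: - $\vdash\cdot\ ctx$; and $\vdash\Gamma,x{:}A\ ctx$ if $\vdash\Gamma\ ctx$, $\Gamma\vdash A:\mathrm{Type}$, $x\notin\mathrm{dom}(\Gamma)$. - $\Gamma\vdash\mathrm{Type}\ kind$ if $\vdash\Gamma\ ctx$; $\Gamma\vdash\Pi x{:}A.K\ kind$ if $\Gamma\vdash A:\mathrm{Type}$ and $\Gamma,x{:}A\vdash K\ kind$. - $\Gamma\vdash a:K^\beta$ if $\vdash\Gamma\ ctx$ and $a:K\in\Sigma$; $\Gamma\vdash\Pi x{:}A.B:\mathrm{Type}$ if $\Gamma\vdash A:\mathrm{Type}$ and $\Gamma,x{:}A\vdash B:\mathrm{Type}$; $\Gamma\vdash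 A\,M:(K[M/x])^\beta$ if $\Gamma\vdash A:\Pi x{:}B.K$ and $\Gamma\vdash M:B$. - $\Gamma\vdash u:A^\beta$ if $\vdash\Gamma\ ctx$ and $u:A$ is in $\Gamma$ or $\Sigma$; $\Gamma\vdash\lambda x{:}A.M:\Pi x{:}A^\beta.B$ if $\Gamma\vdash A:\mathrm{Type}$ and $\Gamma,x{:}A\vdash M:B$; $\Gamma\vdash M\,N:(B[N/x])^\beta$ if $\Gamma\vdash M:\Pi x{:}A.B$ and $\Gamma\vdash N:A$. A base type is $a\,M_1\cdots M_k$ where the kind of $a$ has exactly $k$ leading $\Pi$s. An expression is canonical if it is $\beta$-normal and every occurrence of a variable or constant in it is applied to as many arguments as there are leading $\Pi$s in its type or kind. The signature $\Sigma$, the context $\Gamma$ and the object $M$ are assumed canonical. **Encoding.** hohh terms are simply typed $\lambda$-terms over atomic types $o$, $\mathit{lf\text{-}type}$, $\mathit{lf\text{-}obj}$. Let $\phi(A)=\mathit{lf\text{-}obj}$ for $A$ a base type, $\phi(\mathrm{Type})=\mathit{lf\text{-}type}$, $\phi(\Pi x{:}A.P)=\phi(A)\to\phi(P)$. Each LF constant or variable with type or kind $P$ is an hohh constant or variable of type $\phi(P)$, and $\langle u\,M_1\cdots M_k\rangle=u\,\langle M_1\rangle\cdots\langle M_k\rangle$ for $u$ a constant or variable, $\langle\lambda x{:}A.M\rangle=\lambda x.\langle M\rangle$ with $x$ of type $\phi(A)$. **Inverse encoding.** The judgment $\Gamma;M\longrightarrow_\Sigma M':T$ ($M$ an hohh term,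 $M'$ an LF object, $T$ an LF type) is defined inductively by: - (inv-abs) $\Gamma;(\lambda x.M)\longrightarrow_\Sigma(\lambda x{:}A.M'):\Pi x{:}A.B$ if $\Gamma,x{:}A;M\longrightarrow_\Sigma M':B$. - (inv-const) $\Gamma;(c\,M_1\cdots M_k)\longrightarrow_\Sigma(c\,M_1'\cdots M_k'):A[M_1'/x_1,\ldots,M_k'/x_k]$ if $c:\Pi x_1{:}T_1.\cdots\Pi x_k{:}T_k.A\in\Sigma$ and $\Gamma;M_i\longrightarrow_\Sigma M_i':T_i[M_1'/x_1,\ldots,M_{i-1}'/x_{i-1}]$ for each $1\le i\le k$. - (inv-var) the same as inv-const, with a variable $x:\Pi y_1{:}T_1.\cdots\Pi y_k{:}T_k.A\in\Gamma$ in place of $c$. Types resulting from substitution are read as their $\beta$-normal forms. When $\Gamma;M\longrightarrow_\Sigma M':T$ is derivable one writes $M'=inv_T(M)$. *)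

theory Defs
  imports Main
begin

text \<open>Expressions are taken up to renaming of bound variables by using de Bruijn indices:
  \<open>TPi A B\<close>, \<open>KPi A K\<close> and \<open>Lam A M\<close> bind index 0 in their second argument. Type constants and
  object constants share one type of names.\<close>

datatype 'c ty =
    TConst 'c
  | TPi "'c ty" "'c ty"
  | TApp "'c ty" "'c obj"
and 'c obj =
    Const 'c
  | Var nat
  | Lam "'c ty" "'c obj"
  | App "'c obj" "'c obj"

datatype 'c kind = Type | KPi "'c ty" "'c kind"

datatype 'c decl = TyDecl 'c "'c kind" | ObjDecl 'c "'c ty"

primrec decl_name :: "'c decl \<Rightarrow> 'c" where
  "decl_name (TyDecl a K) = a"
| "decl_name (ObjDecl c A) = c"

text \<open>Signatures and contexts are lists whose head is the most recent declaration; the variable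
  with index \<open>n\<close> is declared by the entry at position \<open>n\<close> of the context.\<close>

type_synonym 'c sig = "'c decl list"
type_synonym 'c ctx = "'c ty list"


section \<open>Substitution\<close>

definition up_ren :: "(nat \<Rightarrow> nat) \<Rightarrow> nat \<Rightarrow> nat" where
  "up_ren r = case_nat 0 (\<lambda>n. Suc (r n))"

primrec ren_ty :: "(nat \<Rightarrow> nat) \<Rightarrow> 'c ty \<Rightarrow> 'c ty"
  and ren_obj :: "(nat \<Rightarrow> nat) \<Rightarrow> 'c obj \<Rightarrow> 'c obj" where
  "ren_ty r (TConst a) = TConst a"
| "ren_ty r (TPi A B) = TPi (ren_ty r A) (ren_ty (up_ren r) B)"
| "ren_ty r (TApp A M) = TApp (ren_ty r A) (ren_obj r M)"
| "ren_obj r (Const c) = Const c"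
| "ren_obj r (Var n) = Var (r n)"
| "ren_obj r (Lam A M) = Lam (ren_ty r A) (ren_obj (up_ren r) M)"
| "ren_obj r (App M N) = App (ren_obj r M) (ren_obj r N)"

definition up :: "(nat \<Rightarrow> 'c obj) \<Rightarrow> nat \<Rightarrow> 'c obj" where
  "up s = case_nat (Var 0) (\<lambda>n. ren_obj Suc (s n))"

primrec subst_ty :: "(nat \<Rightarrow> 'c obj) \<Rightarrow> 'c ty \<Rightarrow> 'c ty"
  and subst_obj :: "(nat \<Rightarrow> 'c obj) \<Rightarrow> 'c obj \<Rightarrow> 'c obj" where
  "subst_ty s (TConst a) = TConst a"
| "subst_ty s (TPi A B) = TPi (subst_ty s A) (subst_ty (up s) B)"
| "subst_ty s (TApp A M) = TApp (subst_ty s A) (subst_obj s M)"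
| "subst_obj s (Const c) = Const c"
| "subst_obj s (Var n) = s n"
| "subst_obj s (Lam A M) = Lam (subst_ty s A) (subst_obj (up s) M)"
| "subst_obj s (App M N) = App (subst_obj s M) (subst_obj s N)"

primrec subst_kind :: "(nat \<Rightarrow> 'c obj) \<Rightarrow> 'c kind \<Rightarrow> 'c kind" where
  "subst_kind s Type = Type"
| "subst_kind s (KPi A K) = KPi (subst_ty s A) (subst_kind (up s) K)"

text \<open>\<open>inst [M\<^sub>1, \<dots>, M\<^sub>k]\<close> is the simultaneous substitution \<open>[M\<^sub>1/x\<^sub>1, \<dots>, M\<^sub>k/x\<^sub>k]\<close> for the \<open>k\<close>
  innermost variables, \<open>x\<^sub>k\<close> being the one with index 0.\<close>

definition inst :: "'c obj list \<Rightarrow> nat \<Rightarrow> 'c obj" where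
  "inst Ms n = (if n < length Ms then rev Ms ! n else Var (n - length Ms))"

text \<open>The type of variable \<open>n\<close>, weakened to the whole context.\<close>

definition lookup :: "'c ctx \<Rightarrow> nat \<Rightarrow> 'c ty" where
  "lookup G n = ren_ty (\<lambda>m. m + Suc n) (G ! n)"


section \<open>Beta normal forms\<close>

inductive beta_ty :: "'c ty \<Rightarrow> 'c ty \<Rightarrow> bool"
  and beta_obj :: "'c obj \<Rightarrow> 'c obj \<Rightarrow> bool" where
  "beta_ty A A' \<Longrightarrow> beta_ty (TPi A B) (TPi A' B)"
| "beta_ty B B' \<Longrightarrow> beta_ty (TPi A B) (TPi A B')"
| "beta_ty A A' \<Longrightarrow> beta_ty (TApp A M) (TApp A' M)"
| "beta_obj M M' \<Longrightarrow> beta_ty (TApp A M) (TApp A M')"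
| "beta_obj (App (Lam A M) N) (subst_obj (inst [N]) M)"
| "beta_ty A A' \<Longrightarrow> beta_obj (Lam A M) (Lam A' M)"
| "beta_obj M M' \<Longrightarrow> beta_obj (Lam A M) (Lam A M')"
| "beta_obj M M' \<Longrightarrow> beta_obj (App M N) (App M' N)"
| "beta_obj N N' \<Longrightarrow> beta_obj (App M N) (App M N')"

inductive beta_kind :: "'c kind \<Rightarrow> 'c kind \<Rightarrow> bool" where
  "beta_ty A A' \<Longrightarrow> beta_kind (KPi A K) (KPi A' K)"
| "beta_kind K K' \<Longrightarrow> beta_kind (KPi A K) (KPi A K')"

definition normal :: "('a \<Rightarrow> 'a \<Rightarrow> bool) \<Rightarrow> 'a \<Rightarrow> bool" where
  "normal R x \<longleftrightarrow> (\<nexists>y. R x y)"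

text \<open>Since raw expressions need not have a normal form, \<open>V = U\<^sup>\<beta>\<close> is rendered as a relation between
  \<open>U\<close> and \<open>V\<close>.\<close>

definition nf_of :: "('a \<Rightarrow> 'a \<Rightarrow> bool) \<Rightarrow> 'a \<Rightarrow> 'a \<Rightarrow> bool" where
  "nf_of R U V \<longleftrightarrow> R\<^sup>*\<^sup>* U V \<and> normal R V"


section \<open>LF judgments\<close>

inductive wf_ctx :: "'c sig \<Rightarrow> 'c ctx \<Rightarrow> bool"
  and wf_kind :: "'c sig \<Rightarrow> 'c ctx \<Rightarrow> 'c kind \<Rightarrow> bool"
  and of_kind :: "'c sig \<Rightarrow> 'c ctx \<Rightarrow> 'c ty \<Rightarrow> 'c kind \<Rightarrow> bool"
  and of_type :: "'c sig \<Rightarrow> 'c ctx \<Rightarrow> 'c obj \<Rightarrow> 'c ty \<Rightarrow> bool"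
  for S :: "'c sig" where
  ctx_nil: "wf_ctx S []"
| ctx_cons: "wf_ctx S G \<Longrightarrow> of_kind S G A Type \<Longrightarrow> wf_ctx S (A # G)"
| kind_type: "wf_ctx S G \<Longrightarrow> wf_kind S G Type"
| kind_pi: "of_kind S G A Type \<Longrightarrow> wf_kind S (A # G) K \<Longrightarrow> wf_kind S G (KPi A K)"
| fam_const: "wf_ctx S G \<Longrightarrow> TyDecl a K \<in> set S \<Longrightarrow> nf_of beta_kind K K' \<Longrightarrow>
    of_kind S G (TConst a) K'"
| fam_pi: "of_kind S G A Type \<Longrightarrow> of_kind S (A # G) B Type \<Longrightarrow> of_kind S G (TPi A B) Type"
| fam_app: "of_kind S G A (KPi B K) \<Longrightarrow> of_type S G M B \<Longrightarrow>
    nf_of beta_kind (subst_kind (inst [M]) K) K' \<Longrightarrow> of_kind S G (TApp A M) K'"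
| obj_const: "wf_ctx S G \<Longrightarrow> ObjDecl c A \<in> set S \<Longrightarrow> nf_of beta_ty A A' \<Longrightarrow>
    of_type S G (Const c) A'"
| obj_var: "wf_ctx S G \<Longrightarrow> n < length G \<Longrightarrow> nf_of beta_ty (lookup G n) A' \<Longrightarrow>
    of_type S G (Var n) A'"
| obj_lam: "of_kind S G A Type \<Longrightarrow> of_type S (A # G) M B \<Longrightarrow> nf_of beta_ty A A' \<Longrightarrow>
    of_type S G (Lam A M) (TPi A' B)"
| obj_app: "of_type S G M (TPi A B) \<Longrightarrow> of_type S G N A \<Longrightarrow>
    nf_of beta_ty (subst_ty (inst [N]) B) B' \<Longrightarrow> of_type S G (App M N) B'"

primrec wf_decl :: "'c sig \<Rightarrow> 'c decl \<Rightarrow> bool" where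
  "wf_decl S (TyDecl a K) \<longleftrightarrow> wf_kind S [] K"
| "wf_decl S (ObjDecl c A) \<longleftrightarrow> of_kind S [] A Type"

primrec valid_sig :: "'c sig \<Rightarrow> bool" where
  "valid_sig [] \<longleftrightarrow> True"
| "valid_sig (d # S) \<longleftrightarrow> valid_sig S \<and> decl_name d \<notin> decl_name ` set S \<and> wf_decl S d"


section \<open>Canonical expressions\<close>

fun arity_ty :: "'c ty \<Rightarrow> nat" where
  "arity_ty (TPi A B) = Suc (arity_ty B)"
| "arity_ty _ = 0"

primrec arity_kind :: "'c kind \<Rightarrow> nat" where
  "arity_kind Type = 0"
| "arity_kind (KPi A K) = Suc (arity_kind K)"

text \<open>The numeric argument counts the arguments to which the expression is applied.\<close>

primrec full_ty :: "'c sig \<Rightarrow> 'c ctx \<Rightarrow> nat \<Rightarrow> 'c ty \<Rightarrow> bool"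
  and full_obj :: "'c sig \<Rightarrow> 'c ctx \<Rightarrow> nat \<Rightarrow> 'c obj \<Rightarrow> bool" where
  "full_ty S G k (TConst a) \<longleftrightarrow> (\<exists>K. TyDecl a K \<in> set S \<and> arity_kind K = k)"
| "full_ty S G k (TPi A B) \<longleftrightarrow> full_ty S G 0 A \<and> full_ty S (A # G) 0 B"
| "full_ty S G k (TApp A M) \<longleftrightarrow> full_ty S G (Suc k) A \<and> full_obj S G 0 M"
| "full_obj S G k (Const c) \<longleftrightarrow> (\<exists>A. ObjDecl c A \<in> set S \<and> arity_ty A = k)"
| "full_obj S G k (Var n) \<longleftrightarrow> n < length G \<and> arity_ty (lookup G n) = k"
| "full_obj S G k (Lam A M) \<longleftrightarrow> full_ty S G 0 A \<and> full_obj S (A # G) 0 M"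
| "full_obj S G k (App M N) \<longleftrightarrow> full_obj S G (Suc k) M \<and> full_obj S G 0 N"

primrec full_kind :: "'c sig \<Rightarrow> 'c ctx \<Rightarrow> 'c kind \<Rightarrow> bool" where
  "full_kind S G Type \<longleftrightarrow> True"
| "full_kind S G (KPi A K) \<longleftrightarrow> full_ty S G 0 A \<and> full_kind S (A # G) K"

definition canonical_kind :: "'c sig \<Rightarrow> 'c ctx \<Rightarrow> 'c kind \<Rightarrow> bool" where
  "canonical_kind S G K \<longleftrightarrow> normal beta_kind K \<and> full_kind S G K"

definition canonical_ty :: "'c sig \<Rightarrow> 'c ctx \<Rightarrow> 'c ty \<Rightarrow> bool" where
  "canonical_ty S G A \<longleftrightarrow> normal beta_ty A \<and> full_ty S G 0 A"

definition canonical_obj :: "'c sig \<Rightarrow> 'c ctx \<Rightarrow> 'c obj \<Rightarrow> bool" where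
  "canonical_obj S G M \<longleftrightarrow> normal beta_obj M \<and> full_obj S G 0 M"

primrec canonical_ctx :: "'c sig \<Rightarrow> 'c ctx \<Rightarrow> bool" where
  "canonical_ctx S [] \<longleftrightarrow> True"
| "canonical_ctx S (A # G) \<longleftrightarrow> canonical_ctx S G \<and> canonical_ty S G A"

definition canonical_sig :: "'c sig \<Rightarrow> bool" where
  "canonical_sig S \<longleftrightarrow>
    (\<forall>a K. TyDecl a K \<in> set S \<longrightarrow> canonical_kind S [] K) \<and>
    (\<forall>c A. ObjDecl c A \<in> set S \<longrightarrow> canonical_ty S [] A)"


section \<open>Terms of hohh and the encoding\<close>

datatype hty = Ho | LfType | LfObj | Arrow hty hty

datatype 'c hterm =
    HConst 'c
  | HVar nat
  | HLam hty "'c hterm"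
  | HApp "'c hterm" "'c hterm"

text \<open>Every type other than a \<open>\<Pi>\<close>-type is treated like a base type.\<close>

fun phi_ty :: "'c ty \<Rightarrow> hty" where
  "phi_ty (TPi A B) = Arrow (phi_ty A) (phi_ty B)"
| "phi_ty _ = LfObj"

primrec phi_kind :: "'c kind \<Rightarrow> hty" where
  "phi_kind Type = LfType"
| "phi_kind (KPi A K) = Arrow (phi_ty A) (phi_kind K)"

inductive hohh_type :: "'c sig \<Rightarrow> hty list \<Rightarrow> 'c hterm \<Rightarrow> hty \<Rightarrow> bool" for S :: "'c sig" where
  "TyDecl a K \<in> set S \<Longrightarrow> hohh_type S E (HConst a) (phi_kind K)"
| "ObjDecl c A \<in> set S \<Longrightarrow> hohh_type S E (HConst c) (phi_ty A)"
| "n < length E \<Longrightarrow> hohh_type S E (HVar n) (E ! n)"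
| "hohh_type S (t # E) M u \<Longrightarrow> hohh_type S E (HLam t M) (Arrow t u)"
| "hohh_type S E M (Arrow t u) \<Longrightarrow> hohh_type S E N t \<Longrightarrow> hohh_type S E (HApp M N) u"

definition hohh_term :: "'c sig \<Rightarrow> 'c ctx \<Rightarrow> 'c hterm \<Rightarrow> bool" where
  "hohh_term S G M \<longleftrightarrow> (\<exists>t. hohh_type S (map phi_ty G) M t)"

text \<open>Clause by clause on applications, so that
  \<open>enc (u M\<^sub>1 \<dots> M\<^sub>k) = u (enc M\<^sub>1) \<dots> (enc M\<^sub>k)\<close>.\<close>

primrec enc :: "'c obj \<Rightarrow> 'c hterm" where
  "enc (Const c) = HConst c"
| "enc (Var n) = HVar n"
| "enc (Lam A M) = HLam (phi_ty A) (enc M)"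
| "enc (App M N) = HApp (enc M) (enc N)"


section \<open>The inverse encoding\<close>

text \<open>\<open>pis [T\<^sub>1, \<dots>, T\<^sub>k] A\<close> is \<open>\<Pi>x\<^sub>1:T\<^sub>1. \<dots> \<Pi>x\<^sub>k:T\<^sub>k. A\<close>.\<close>

abbreviation pis :: "'c ty list \<Rightarrow> 'c ty \<Rightarrow> 'c ty" where
  "pis Ts A \<equiv> foldr TPi Ts A"

text \<open>The premises \<open>hohh_term\<close> restrict the judgment to simply typed terms, a variable of the context
  having the type assigned by \<open>phi_ty\<close>.\<close>

inductive inv_enc :: "'c sig \<Rightarrow> 'c ctx \<Rightarrow> 'c hterm \<Rightarrow> 'c obj \<Rightarrow> 'c ty \<Rightarrow> bool"
  for S :: "'c sig" where
  inv_abs: "inv_enc S G (HLam (phi_ty A) M) (Lam A M') (TPi A B)"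
  if "hohh_term S G (HLam (phi_ty A) M)"
    and "inv_enc S (A # G) M M' B"
| inv_const: "inv_enc S G (foldl HApp (HConst c) Ms) (foldl App (Const c) Ms') T"
  if "hohh_term S G (foldl HApp (HConst c) Ms)"
    and "ObjDecl c (pis Ts A) \<in> set S"
    and "length Ms = length Ts" and "length Ms' = length Ts"
    and "\<forall>i < length Ts. \<exists>U. nf_of beta_ty (subst_ty (inst (take i Ms')) (Ts ! i)) U \<and>
           inv_enc S G (Ms ! i) (Ms' ! i) U"
    and "nf_of beta_ty (subst_ty (inst Ms') A) T"
| inv_var: "inv_enc S G (foldl HApp (HVar n) Ms) (foldl App (Var n) Ms') T"
  if "hohh_term S G (foldl HApp (HVar n) Ms)"
    and "n < length G" and "lookup G n = pis Ts A"
    and "length Ms = length Ts" and "length Ms' = length Ts"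
    and "\<forall>i < length Ts. \<exists>U. nf_of beta_ty (subst_ty (inst (take i Ms')) (Ts ! i)) U \<and>
           inv_enc S G (Ms ! i) (Ms' ! i) U"
    and "nf_of beta_ty (subst_ty (inst Ms') A) T"

end

theory Submission
  imports Defs
begin

text \<open>A typing derivation for a canonical spine \<open>u M\<^sub>1 \<dots> M\<^sub>k\<close> normalises the type after each
  application, whereas the inverse encoding substitutes all arguments at once and normalises only
  at the end. Reduction is stable under substitution, so the stepwise result is also a normal form
  of the simultaneous instance; neither confluence nor termination is involved. Simple typability of
  \<open>enc M\<close> holds because \<open>phi_ty\<close> is invariant under substitution and reduction.\<close>

section \<open>Substitution calculus\<close>

lemma up_ren_simps [simp]: "up_ren r 0 = 0" "up_ren r (Suc n) = Suc (r n)"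
  by (simp_all add: up_ren_def)

lemma up_simps [simp]: "up s 0 = Var 0" "up s (Suc n) = ren_obj Suc (s n)"
  by (simp_all add: up_def)

lemma inst_single [simp]: "inst [N] 0 = N" "inst [N] (Suc n) = Var n"
  by (simp_all add: inst_def)

lemma inst_Nil: "inst [] = Var"
  by (simp add: fun_eq_iff inst_def)

lemma inst_snoc [simp]: "inst (Ms @ [N]) 0 = N" "inst (Ms @ [N]) (Suc n) = inst Ms n"
  by (simp_all add: inst_def)

text \<open>Substitutions are compared at index 0 and at successors, the two cases by which
  \<open>up\<close> and \<open>up_ren\<close> are defined.\<close>

lemma fun_eq_natI: "f 0 = g 0 \<Longrightarrow> (\<And>n. f (Suc n) = g (Suc n)) \<Longrightarrow> f = g"
  by (metis ext not0_implies_Suc)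

lemma up_Var: "up Var = Var"
  by (rule fun_eq_natI) simp_all

lemma subst_Var:
  fixes A :: "'c ty" and M :: "'c obj"
  shows "subst_ty Var A = A" and "subst_obj Var M = M"
  by (induction A and M) (simp_all add: up_Var)

lemma ren_ren:
  fixes A :: "'c ty" and M :: "'c obj"
  shows "ren_ty q (ren_ty r A) = ren_ty (q \<circ> r) A"
    and "ren_obj q (ren_obj r M) = ren_obj (q \<circ> r) M"
proof (induction A and M arbitrary: q r and q r)
  case (TPi A B)
  have "up_ren q \<circ> up_ren r = up_ren (q \<circ> r)" by (rule fun_eq_natI) simp_all
  with TPi show ?case by (simp add: comp_def)
next
  case (Lam A M)
  have "up_ren q \<circ> up_ren r = up_ren (q \<circ> r)" by (rule fun_eq_natI) simp_all
  with Lam show ?case by (simp add: comp_def)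
qed simp_all

lemma subst_ren:
  fixes A :: "'c ty" and M :: "'c obj"
  shows "subst_ty s (ren_ty r A) = subst_ty (s \<circ> r) A"
    and "subst_obj s (ren_obj r M) = subst_obj (s \<circ> r) M"
proof (induction A and M arbitrary: s r and s r)
  case (TPi A B)
  have "up s \<circ> up_ren r = up (s \<circ> r)" by (rule fun_eq_natI) simp_all
  with TPi show ?case by (simp add: comp_def)
next
  case (Lam A M)
  have "up s \<circ> up_ren r = up (s \<circ> r)" by (rule fun_eq_natI) simp_all
  with Lam show ?case by (simp add: comp_def)
qed simp_all

lemma up_ren_comp: "ren_obj (up_ren r) \<circ> up s = up (ren_obj r \<circ> s)"
proof (rule fun_eq_natI)
  have "up_ren r \<circ> Suc = Suc \<circ> r" by (simp add: fun_eq_iff)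
  then show "(ren_obj (up_ren r) \<circ> up s) (Suc n) = up (ren_obj r \<circ> s) (Suc n)" for n
    by (simp add: ren_ren)
qed simp

lemma ren_subst:
  fixes A :: "'c ty" and M :: "'c obj"
  shows "ren_ty r (subst_ty s A) = subst_ty (ren_obj r \<circ> s) A"
    and "ren_obj r (subst_obj s M) = subst_obj (ren_obj r \<circ> s) M"
  by (induction A and M arbitrary: s r and s r) (simp_all add: up_ren_comp)

text \<open>The binder case of \<open>subst_subst\<close>. At a successor the weakening by
  \<open>Suc\<close> has to be moved across a substitution, hence the mixed laws
  \<open>subst_ren\<close> and \<open>ren_subst\<close> come first.\<close>

lemma up_comp: "subst_obj (up t) \<circ> up s = up (subst_obj t \<circ> s)"
proof (rule fun_eq_natI)
  have "up t \<circ> Suc = ren_obj Suc \<circ> t" by (simp add: fun_eq_iff)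
  then show "(subst_obj (up t) \<circ> up s) (Suc n) = up (subst_obj t \<circ> s) (Suc n)" for n
    by (simp add: subst_ren ren_subst)
qed simp

lemma subst_subst:
  fixes A :: "'c ty" and M :: "'c obj"
  shows "subst_ty t (subst_ty s A) = subst_ty (subst_obj t \<circ> s) A"
    and "subst_obj t (subst_obj s M) = subst_obj (subst_obj t \<circ> s) M"
  by (induction A and M arbitrary: s t and s t) (simp_all add: up_comp)

lemma subst_inst_ren_Suc: "subst_obj (inst [N]) (ren_obj Suc M) = M"
proof -
  have "inst [N] \<circ> Suc = Var" by (simp add: fun_eq_iff)
  then show ?thesis by (simp add: subst_ren subst_Var)
qed

text \<open>Links the argument-by-argument instantiation of \<open>obj_app\<close> with the
  simultaneous one of \<open>inv_const\<close> and \<open>inv_var\<close>.\<close>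

lemma subst_inst_up_inst:
  "subst_ty (inst [N]) (subst_ty (up (inst Ms)) A) = subst_ty (inst (Ms @ [N])) A"
proof -
  have "subst_obj (inst [N]) \<circ> up (inst Ms) = inst (Ms @ [N])"
    by (rule fun_eq_natI) (simp_all add: subst_inst_ren_Suc)
  then show ?thesis by (simp add: subst_subst)
qed

text \<open>The redex case of \<open>beta_subst\<close>: substituting into a contractum gives the
  contractum of the substituted redex.\<close>

lemma subst_inst_commute:
  "subst_obj s (subst_obj (inst [N]) M) = subst_obj (inst [subst_obj s N]) (subst_obj (up s) M)"
proof -
  have "subst_obj s \<circ> inst [N] = subst_obj (inst [subst_obj s N]) \<circ> up s"
    by (rule fun_eq_natI) (simp_all add: subst_inst_ren_Suc)
  then show ?thesis by (simp add: subst_subst)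
qed

section \<open>Reduction and normal forms\<close>

lemma beta_subst:
  "beta_ty A A' \<Longrightarrow> beta_ty (subst_ty s A) (subst_ty s A')"
  "beta_obj M M' \<Longrightarrow> beta_obj (subst_obj s M) (subst_obj s M')"
  by (induction A A' and M M' arbitrary: s and s rule: beta_ty_beta_obj.inducts)
    (auto simp: subst_inst_commute intro: beta_ty_beta_obj.intros)

lemma betas_subst: "beta_ty\<^sup>*\<^sup>* A A' \<Longrightarrow> beta_ty\<^sup>*\<^sup>* (subst_ty s A) (subst_ty s A')"
  by (induction rule: rtranclp_induct) (auto intro: beta_subst rtranclp.rtrancl_into_rtrancl)

text \<open>The reduction from \<open>A\<close> to \<open>A'\<close> is carried through
  \<open>s\<close> and prolonged to \<open>V\<close>. This bypasses the intermediate normal form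
  produced by a typing rule.\<close>

lemma nf_of_subst:
  assumes "nf_of beta_ty A A'" and "nf_of beta_ty (subst_ty s A') V"
  shows "nf_of beta_ty (subst_ty s A) V"
  using assms betas_subst[of A A' s] by (auto simp: nf_of_def)

lemma nf_of_normal: "nf_of R U V \<Longrightarrow> normal R U \<Longrightarrow> V = U"
  by (auto simp: nf_of_def normal_def elim: converse_rtranclpE)

lemma nf_of_refl: "normal R U \<Longrightarrow> nf_of R U U"
  by (simp add: nf_of_def)

inductive_cases beta_ty_TPiE: "beta_ty (TPi A B) C"

lemma betas_TPi:
  "beta_ty\<^sup>*\<^sup>* (TPi A B) C \<Longrightarrow> \<exists>A' B'. C = TPi A' B' \<and> beta_ty\<^sup>*\<^sup>* A A' \<and> beta_ty\<^sup>*\<^sup>* B B'"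
  by (induction rule: rtranclp_induct)
    (auto elim!: beta_ty_TPiE intro: rtranclp.rtrancl_into_rtrancl)

text \<open>Reductions of a product split componentwise, and a step of a component would be a step
  of the product.\<close>

lemma nf_of_TPi:
  assumes "nf_of beta_ty (TPi A B) (TPi A' B')"
  shows "nf_of beta_ty A A'" and "nf_of beta_ty B B'"
  using assms betas_TPi[of A B "TPi A' B'"]
  by (auto simp: nf_of_def normal_def intro: beta_ty_beta_obj.intros)

inductive_cases beta_ty_TConstE: "beta_ty (TConst a) C"
inductive_cases beta_ty_TAppE: "beta_ty (TApp A M) C"
inductive_cases beta_obj_ConstE: "beta_obj (Const c) P"
inductive_cases beta_obj_VarE: "beta_obj (Var n) P"
inductive_cases beta_obj_LamE: "beta_obj (Lam A M) P"
inductive_cases beta_obj_AppE: "beta_obj (App M N) P"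

text \<open>A renaming sends variables to variables and so creates no redex. The existence of some
  step suffices to transfer normality to the weakened types returned by
  \<open>lookup\<close>.\<close>

lemma beta_ren_reducible:
  fixes A :: "'c ty" and M :: "'c obj"
  shows "beta_ty (ren_ty r A) B \<Longrightarrow> \<exists>A'. beta_ty A A'"
    and "beta_obj (ren_obj r M) P \<Longrightarrow> \<exists>M'. beta_obj M M'"
proof (induction A and M arbitrary: r B and r P)
  case (App M N)
  from App.prems consider (redex) A L where "ren_obj r M = Lam A L"
    | (left) M' where "beta_obj (ren_obj r M) M'"
    | (right) N' where "beta_obj (ren_obj r N) N'"
    by (auto elim: beta_obj_AppE)
  then show ?case
  proof cases
    case redex
    then obtain A' L' where "M = Lam A' L'" by (cases M) auto
    then show ?thesis by (auto intro: beta_ty_beta_obj.intros)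
  qed (use App.IH in \<open>blast intro: beta_ty_beta_obj.intros\<close>)+
qed (fastforce intro: beta_ty_beta_obj.intros elim: beta_ty_TConstE beta_ty_TAppE beta_ty_TPiE
      beta_obj_ConstE beta_obj_VarE beta_obj_LamE)+

lemma normal_ren_ty: "normal beta_ty A \<Longrightarrow> normal beta_ty (ren_ty r A)"
  unfolding normal_def using beta_ren_reducible(1) by blast

lemma canonical_ctx_nth: "canonical_ctx S G \<Longrightarrow> n < length G \<Longrightarrow> normal beta_ty (G ! n)"
  by (induction G arbitrary: n) (auto simp: canonical_ty_def nth_Cons split: nat.split)

lemma canonical_ctx_lookup: "canonical_ctx S G \<Longrightarrow> n < length G \<Longrightarrow> normal beta_ty (lookup G n)"
  by (simp add: lookup_def normal_ren_ty canonical_ctx_nth)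

section \<open>Simple types\<close>

lemma phi_ren [simp]: "phi_ty (ren_ty r A) = phi_ty A"
  by (induction A arbitrary: r rule: phi_ty.induct) simp_all

text \<open>\<open>phi_ty\<close> reads only the \<open>TPi\<close> structure of a type, whereas a
  substitution changes only object arguments.\<close>

lemma phi_subst [simp]: "phi_ty (subst_ty s A) = phi_ty A"
  by (induction A arbitrary: s rule: phi_ty.induct) simp_all

text \<open>Steps inside objects are invisible to \<open>phi_ty\<close>, so the induction carries a
  trivial predicate on the object side.\<close>

lemma phi_beta: "beta_ty A A' \<Longrightarrow> phi_ty A' = phi_ty A"
  by (induction A A' rule: beta_ty_beta_obj.inducts(1)[where ?P2.0 = "\<lambda>_ _. True"]) simp_all

lemma phi_nf: "nf_of beta_ty A A' \<Longrightarrow> phi_ty A' = phi_ty A"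
proof -
  have "beta_ty\<^sup>*\<^sup>* A A' \<Longrightarrow> phi_ty A' = phi_ty A"
    by (induction rule: rtranclp_induct) (auto simp: phi_beta)
  then show "nf_of beta_ty A A' \<Longrightarrow> phi_ty A' = phi_ty A" by (simp add: nf_of_def)
qed

lemma hohh_type_Var:
  assumes "n < length G"
  shows "hohh_type S (map phi_ty G) (HVar n) (phi_ty (lookup G n))"
  using assms hohh_type.intros(3)[of n "map phi_ty G" S] by (simp add: lookup_def)

inductive_cases of_type_ConstE: "of_type S G (Const c) T"
inductive_cases of_type_VarE: "of_type S G (Var n) T"
inductive_cases of_type_LamE: "of_type S G (Lam A M) T"
inductive_cases of_type_AppE: "of_type S G (App M N) T"

text \<open>Instantiation, weakening and normalisation in the LF rules leave \<open>phi_ty\<close>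
  unchanged, so each rule turns into its simply typed counterpart.\<close>

lemma hohh_type_enc:
  "of_type S G M T \<Longrightarrow> hohh_type S (map phi_ty G) (enc M) (phi_ty T)"
proof (induction M arbitrary: G T rule: obj.induct[where ?P1.0 = "\<lambda>_. True"])
  case (Const c)
  then show ?case
    by (auto elim!: of_type_ConstE simp: phi_nf intro: hohh_type.intros)
next
  case (Var n)
  then show ?case
    by (auto elim!: of_type_VarE simp: phi_nf hohh_type_Var)
next
  case (Lam A M)
  from Lam.prems obtain A' B where "T = TPi A' B" "of_type S (A # G) M B" "nf_of beta_ty A A'"
    by (elim of_type_LamE)
  then show ?case using Lam.IH[of "A # G" B] by (simp add: phi_nf hohh_type.intros)
next
  case (App M N)
  from App.prems obtain A B where
    "of_type S G M (TPi A B)" "of_type S G N A" "nf_of beta_ty (subst_ty (inst [N]) B) T"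
    by (elim of_type_AppE)
  then show ?case using App.IH(1)[of G "TPi A B"] App.IH(2)[of G A]
    by (auto simp: phi_nf intro: hohh_type.intros)
qed simp_all

lemma hohh_term_enc: "of_type S G M T \<Longrightarrow> hohh_term S G (enc M)"
  unfolding hohh_term_def using hohh_type_enc by blast

section \<open>Spines\<close>

lemma enc_foldl_App: "enc (foldl App M Ms) = foldl HApp (enc M) (map enc Ms)"
  by (induction Ms arbitrary: M) simp_all

lemma normal_Lam:
  assumes "normal beta_obj (Lam A M)"
  shows "normal beta_ty A" and "normal beta_obj M"
  using assms by (auto simp: normal_def intro: beta_ty_beta_obj.intros)

lemma normal_App:
  assumes "normal beta_obj (App M N)"
  shows "normal beta_obj M" and "normal beta_obj N" and "M \<noteq> Lam A L"
  using assms by (auto simp: normal_def intro: beta_ty_beta_obj.intros)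

text \<open>The function part of a normal application is never a \<open>Lam\<close>, so peeling off
  arguments ends at a constant or a variable.\<close>

lemma normal_cases:
  fixes M :: "'c obj"
  assumes "normal beta_obj M"
  obtains (Lam) A L where "M = Lam A L"
  | (Const) c Ms where "M = foldl App (Const c) Ms"
  | (Var) n Ms where "M = foldl App (Var n) Ms"
proof -
  have "(\<exists>A L. M = Lam A L) \<or> (\<exists>c Ms. M = foldl App (Const c) Ms) \<or>
      (\<exists>n Ms. M = foldl App (Var n) Ms)"
    using assms
  proof (induction M rule: obj.induct[where ?P1.0 = "\<lambda>_. True"])
    case (Const c)
    have "Const c = foldl App (Const c) []" by simp
    then show ?case by blast
  next
    case (Var n)
    have "Var n = foldl App (Var n) []" by simp
    then show ?case by blast
  next
    case (App M N)
    have snoc: "App (foldl App h Ms) N = foldl App h (Ms @ [N])" for h Ms by simp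
    from App.IH(1) normal_App[OF App.prems] show ?case by (metis snoc)
  qed simp_all
  with that show thesis by blast
qed

lemma normal_spine:
  "normal beta_obj (foldl App h Ms) \<Longrightarrow> N \<in> set Ms \<Longrightarrow> normal beta_obj N"
  by (induction Ms rule: rev_induct) (auto dest: normal_App)

lemma full_spine:
  "full_obj S G k (foldl App h Ms) \<longleftrightarrow>
    full_obj S G (k + length Ms) h \<and> (\<forall>N \<in> set Ms. full_obj S G 0 N)"
  by (induction Ms arbitrary: k rule: rev_induct) auto

text \<open>Spine arguments may lie deep inside the term; an induction on \<open>size\<close>
  reaches all of them at once.\<close>

lemma size_spine: "N \<in> set Ms \<Longrightarrow> size N < size (foldl App h Ms)"
  by (induction Ms rule: rev_induct) auto

text \<open>Taking all leading products makes \<open>Ts\<close> as long as the argument list of a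
  fully applied head.\<close>

lemma arity_pis: obtains Ts A where "B = pis Ts A" "length Ts = arity_ty B"
proof -
  have "\<exists>Ts A. B = pis Ts A \<and> length Ts = arity_ty B"
  proof (induction B rule: arity_ty.induct)
    case (1 A B)
    then obtain Ts C where "B = pis Ts C" "length Ts = arity_ty B" by blast
    then have "TPi A B = pis (A # Ts) C \<and> length (A # Ts) = arity_ty (TPi A B)" by simp
    then show ?case by blast
  qed auto
  with that show thesis by blast
qed

text \<open>Arguments are peeled off from the right. Since \<open>head\<close> fixes the only
  possible type of \<open>h\<close>, inverting each application yields normal forms of instances of
  \<open>Ts\<close> and \<open>A\<close>.\<close>

lemma of_type_spine:
  assumes head: "\<And>H. of_type S G h H \<Longrightarrow> H = pis Ts A"
    and "normal beta_ty (pis Ts A)"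
    and "of_type S G (foldl App h Ms) T"
    and "length Ms = length Ts"
  shows "\<forall>i < length Ts. \<exists>U. nf_of beta_ty (subst_ty (inst (take i Ms)) (Ts ! i)) U \<and>
      of_type S G (Ms ! i) U" (is "?args Ms Ts")
    and "nf_of beta_ty (subst_ty (inst Ms) A) T"
proof -
  have "?args Ms Ts \<and> nf_of beta_ty (subst_ty (inst Ms) A) T"
    using assms
  proof (induction Ms arbitrary: Ts A T rule: rev_induct)
    case Nil
    then show ?case by (auto simp: inst_Nil subst_Var nf_of_refl)
  next
    case (snoc N Ms)
    from snoc.prems(4) obtain Ts' B where Ts: "Ts = Ts' @ [B]"
      by (cases Ts rule: rev_cases) auto
    from snoc.prems(3) obtain A' B' where M: "of_type S G (foldl App h Ms) (TPi A' B')"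
      and N: "of_type S G N A'" and T: "nf_of beta_ty (subst_ty (inst [N]) B') T"
      by (auto elim: of_type_AppE)
    \<comment> \<open>\<open>pis (Ts' @ [B]) A\<close> equals \<open>pis Ts' (TPi B A)\<close>: the
      last product moves into the result type of the shorter spine.\<close>
    have "?args Ms Ts' \<and> nf_of beta_ty (subst_ty (inst Ms) (TPi B A)) (TPi A' B')"
      by (rule snoc.IH[OF _ _ M]) (use snoc.prems Ts in auto)
    then have args: "?args Ms Ts'"
      and B: "nf_of beta_ty (subst_ty (inst Ms) B) A'"
      and A: "nf_of beta_ty (subst_ty (up (inst Ms)) A) B'"
      using nf_of_TPi[of "subst_ty (inst Ms) B" "subst_ty (up (inst Ms)) A" A' B'] by auto
    have len: "length Ms = length Ts'" using snoc.prems(4) Ts by simp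
    \<comment> \<open>At the new last index \<open>take\<close> returns all of \<open>Ms\<close>,
      and the witness is \<open>A'\<close>.\<close>
    have "?args (Ms @ [N]) Ts"
      using args B N len by (auto simp: Ts nth_append less_Suc_eq)
    moreover have "nf_of beta_ty (subst_ty (inst (Ms @ [N])) A) T"
      using nf_of_subst[OF A T] by (simp add: subst_inst_up_inst)
    ultimately show ?case by blast
  qed
  then show "?args Ms Ts" and "nf_of beta_ty (subst_ty (inst Ms) A) T" by auto
qed

text \<open>Each declared name is fresh for the earlier declarations; this fixes the type of a
  constant head.\<close>

lemma valid_sig_unique:
  assumes "valid_sig S" and "d \<in> set S" and "e \<in> set S" and "decl_name d = decl_name e"
  shows "d = e"
  using assms by (induction S) (auto simp: image_iff)

theorem theorem7:
  fixes S :: "'c sig" and G :: "'c ctx" and M :: "'c obj" and T :: "'c ty"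
  assumes "valid_sig S"
    and "canonical_sig S"
    and "canonical_ctx S G"
    and "canonical_obj S G M"
    and "of_type S G M T"
  shows "inv_enc S G (enc M) M T"
  using assms(3-)
proof (induction M arbitrary: G T rule: measure_induct_rule[of size])
  case (less M)
  note typed = \<open>of_type S G M T\<close>
  have normal: "normal beta_obj M" and full: "full_obj S G 0 M"
    using less.prems(2) by (auto simp: canonical_obj_def)
  have hohh: "hohh_term S G (enc M)" using typed by (rule hohh_term_enc)
  \<comment> \<open>Shared by constant and variable heads: the induction hypothesis turns typings of
    the arguments into inverse encodings at the same types.\<close>
  have args: "\<forall>i < length Ts. \<exists>U. nf_of beta_ty (subst_ty (inst (take i Ms)) (Ts ! i)) U \<and>
        inv_enc S G (map enc Ms ! i) (Ms ! i) U"
    if "\<forall>i < length Ts. \<exists>U. nf_of beta_ty (subst_ty (inst (take i Ms)) (Ts ! i)) U \<and>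
        of_type S G (Ms ! i) U"
      and M: "M = foldl App h Ms" and len: "length Ms = length Ts" for h Ms Ts
  proof -
    have "inv_enc S G (enc N) N U" if N: "N \<in> set Ms" and "of_type S G N U" for N U
    proof (rule less.IH)
      show "size N < size M" using N M by (simp add: size_spine)
      show "canonical_obj S G N"
        using N normal full by (auto simp: M canonical_obj_def full_spine intro: normal_spine)
    qed (use less.prems that in auto)
    with that show ?thesis by (metis nth_map nth_mem)
  qed
  from normal show ?case
  proof (cases rule: normal_cases)
    case (Lam A L)
    from typed Lam obtain A' B
      where T: "T = TPi A' B" and L: "of_type S (A # G) L B" and A': "nf_of beta_ty A A'"
      by (auto elim: of_type_LamE)
    have nA: "normal beta_ty A" and nL: "normal beta_obj L"
      using normal Lam normal_Lam by blast+
    \<comment> \<open>\<open>obj_lam\<close> normalises the label in the product while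
      \<open>inv_abs\<close> keeps it as it is; normality of \<open>A\<close> makes the two
      agree.\<close>
    have "A' = A" using nf_of_normal[OF A' nA] .
    moreover have "inv_enc S (A # G) (enc L) L B"
      by (rule less.IH)
        (use Lam nA nL full L less.prems in \<open>auto simp: canonical_obj_def canonical_ty_def\<close>)
    ultimately show ?thesis using hohh by (auto simp: Lam T intro: inv_abs)
  next
    case (Const c Ms)
    from full obtain B where c: "ObjDecl c B \<in> set S" and B: "arity_ty B = length Ms"
      by (auto simp: Const full_spine)
    obtain Ts A where Ts: "B = pis Ts A" and "length Ts = arity_ty B" by (rule arity_pis)
    with B have len: "length Ms = length Ts" by simp
    have nB: "normal beta_ty (pis Ts A)"
      using assms(2) c by (auto simp: canonical_sig_def canonical_ty_def Ts)
    \<comment> \<open>Fullness and typing each supply a declaration of \<open>c\<close>. Uniqueness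
      identifies them, and the declared type is already normal.\<close>
    have head: "H = pis Ts A" if H: "of_type S G (Const c) H" for H
    proof -
      from H obtain B' where "ObjDecl c B' \<in> set S" "nf_of beta_ty B' H"
        by (auto elim: of_type_ConstE)
      moreover from this have "B' = B" using valid_sig_unique[OF assms(1) _ c] by force
      ultimately show ?thesis using nf_of_normal nB by (auto simp: Ts)
    qed
    note spine = of_type_spine[OF head nB typed[unfolded Const] len]
    have "inv_enc S G (foldl HApp (HConst c) (map enc Ms)) (foldl App (Const c) Ms) T"
      using hohh c len args[OF spine(1) Const len] spine(2)
      by (intro inv_const[where Ts = Ts and A = A]) (simp_all add: Const enc_foldl_App Ts)
    then show ?thesis by (simp add: Const enc_foldl_App)
  next
    case (Var n Ms)
    from full have n: "n < length G" and B: "arity_ty (lookup G n) = length Ms"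
      by (auto simp: Var full_spine)
    obtain Ts A where Ts: "lookup G n = pis Ts A" and "length Ts = arity_ty (lookup G n)"
      by (rule arity_pis)
    with B have len: "length Ms = length Ts" by simp
    have nB: "normal beta_ty (pis Ts A)"
      using canonical_ctx_lookup[OF less.prems(1) n] by (simp add: Ts)
    have head: "H = pis Ts A" if "of_type S G (Var n) H" for H
      using that nf_of_normal nB by (auto simp: Ts elim!: of_type_VarE)
    note spine = of_type_spine[OF head nB typed[unfolded Var] len]
    have "inv_enc S G (foldl HApp (HVar n) (map enc Ms)) (foldl App (Var n) Ms) T"
      using hohh n len args[OF spine(1) Var len] spine(2)
      by (intro inv_var[where Ts = Ts and A = A]) (simp_all add: Var enc_foldl_App Ts)
    then show ?thesis by (simp add: Var enc_foldl_App)
  qed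
qed

end
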